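(* Let $L'_7$ be the lattice in $\mathbb{R}^3$ generated by the vectors $(-2,2,2)$, $(3,-3,3)$, and $(4,3,-1)$, and let $\bar S'_{10} = \{(x_1,x_2,x_3) \in \mathbb{R}^3 : x_1,x_2,x_3 \ge 0,\ x_1+x_2+x_3 \le 10\}$. Then $\bar S'_{10} + L'_7 = \mathbb{R}^3$.
   Context: The lattice generated by linearly independent vectors is the set of all their integer linear combinations. $A + B = \{a+b : a \in A, b \in B\}$. *)

theory Defs
  imports "HOL-Analysis.Analysis" "HOL-Library.Set_Algebras"
begin

text \<open>
  Only finite subsets of \<open>B\<close> are summed over, so that no junk value of \<^const>\<open>sum\<close>
  on infinite sets can interfere. The intended use is for linearly independent \<open>B\<close>;
  independence of the generators used here is lemma \<open>independent_basis_L7\<close>.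
\<close>

definition lattice_generated :: "'a::real_vector set \<Rightarrow> 'a set" where
  "lattice_generated B =
     {(\<Sum>v\<in>T. of_int (c v) *\<^sub>R v) | (T :: 'a set) (c :: 'a \<Rightarrow> int). finite T \<and> T \<subseteq> B}"

definition basis_L7 :: "(real ^ 3) set" where
  "basis_L7 = {vector [-2, 2, 2], vector [3, -3, 3], vector [4, 3, -1]}"

definition L7 :: "(real ^ 3) set" where
  "L7 = lattice_generated basis_L7"

definition S10 :: "(real ^ 3) set" where
  "S10 = {x. 0 \<le> x $ 1 \<and> 0 \<le> x $ 2 \<and> 0 \<le> x $ 3 \<and> x $ 1 + x $ 2 + x $ 3 \<le> 10}"

lemma card_basis_L7: "card basis_L7 = 3"
  unfolding basis_L7_def by (simp add: vec_eq_iff forall_3 vector_3)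

lemma independent_basis_L7: "independent basis_L7"
proof -
  let ?a = "vector [-2, 2, 2] :: real ^ 3"
  let ?b = "vector [3, -3, 3] :: real ^ 3"
  let ?c = "vector [4, 3, -1] :: real ^ 3"
  have ne: "?a \<noteq> ?b" "?a \<noteq> ?c" "?b \<noteq> ?c"
    by (simp_all add: vec_eq_iff forall_3 vector_3)
  have "u ?a = 0 \<and> u ?b = 0 \<and> u ?c = 0"
    if "(\<Sum>v\<in>basis_L7. u v *\<^sub>R v) = 0" for u :: "real ^ 3 \<Rightarrow> real"
  proof -
    have "u ?a *\<^sub>R ?a + (u ?b *\<^sub>R ?b + u ?c *\<^sub>R ?c) = 0"
      using that ne by (simp add: basis_L7_def)
    then have "u ?a * -2 + (u ?b * 3 + u ?c * 4) = 0"
      "u ?a * 2 + (u ?b * -3 + u ?c * 3) = 0"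
      "u ?a * 2 + (u ?b * 3 + u ?c * -1) = 0"
      unfolding vec_eq_iff forall_3
      by (simp_all only: vector_add_component vector_scaleR_component vector_3
          zero_index real_scaleR_def)
    then show ?thesis by linarith
  qed
  then show ?thesis
    by (subst independent_explicit) (auto simp: basis_L7_def)
qed

end

theory Submission
  imports Defs
begin

text \<open>
  The lattice is the kernel of \<open>(a, b, c) \<mapsto> 22 a + 57 b + 7 c mod 84\<close> on the integer points, and
  the integer points of the simplex of size 7 already represent every class mod 84. Rounding a real
  point down moves it by a vector with entries in \<open>[0, 1)\<close>, which costs at most 3 in the
  coordinate sum, so the simplex of size 10 suffices.
\<close>

lemma lattice_generated_triple:
  fixes u v w :: "'a::real_vector"
  assumes "u \<noteq> v" "u \<noteq> w" "v \<noteq> w"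
  shows "of_int a *\<^sub>R u + of_int b *\<^sub>R v + of_int c *\<^sub>R w \<in> lattice_generated {u, v, w}"
proof -
  \<comment> \<open>Coefficients in \<open>lattice_generated\<close> are indexed by the vectors
    themselves; distinctness makes \<open>f\<close> take the values \<open>a\<close>,
    \<open>b\<close>, \<open>c\<close> at \<open>u\<close>, \<open>v\<close>,
    \<open>w\<close>.\<close>
  define f where "f = (\<lambda>x. if x = u then a else if x = v then b else c)"
  have "of_int a *\<^sub>R u + of_int b *\<^sub>R v + of_int c *\<^sub>R w = (\<Sum>x\<in>{u, v, w}. of_int (f x) *\<^sub>R x)"
    using assms by (auto simp: f_def)
  then show ?thesis
    unfolding lattice_generated_def by blast
qed

text \<open>The form takes the values 84, -84 and 252 on the generators, whose determinant is 84,
  the number of classes; so the congruence cuts out exactly the lattice.\<close>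

lemma integer_point_in_L7:
  fixes a b c :: int
  assumes "84 dvd 22 * a + 57 * b + 7 * c"
  shows "vector [of_int a, of_int b, of_int c] \<in> L7"
proof -
  obtain k where k: "22 * a + 57 * b + 7 * c = 84 * k"
    using assms by (rule dvdE)
  \<comment> \<open>Cramer's rule, with the divisions by 28, 42 and 7 resolved by adding multiples of \<open>k\<close>.\<close>
  define i where "i = 15 * k - 4 * a - 10 * b - c"
  define j where "j = 50 * k - 13 * a - 34 * b - 4 * c"
  define l where "l = 12 * k - 3 * a - 8 * b - c"
  have "a = -2 * i + 3 * j + 4 * l" "b = 2 * i - 3 * j + 3 * l" "c = 2 * i + 3 * j - l"
    using k by (simp_all add: i_def j_def l_def)
  then have "vector [of_int a, of_int b, of_int c] =
      of_int i *\<^sub>R vector [-2, 2, 2] + of_int j *\<^sub>R vector [3, -3, 3]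
      + of_int l *\<^sub>R (vector [4, 3, -1] :: real ^ 3)"
    by (simp add: vec_eq_iff forall_3 vector_3)
  also have "\<dots> \<in> L7"
    unfolding L7_def basis_L7_def
    by (rule lattice_generated_triple) (simp_all add: vec_eq_iff forall_3 vector_3)
  finally show ?thesis .
qed

text \<open>Sorted by residue: counting from 0, entry \<open>r\<close> is a point of class
  \<open>r\<close>.\<close>

definition residue_witnesses :: "(int \<times> int \<times> int) list" where
  "residue_witnesses =
     [(0, 0, 0), (0, 1, 4), (1, 1, 1), (0, 3, 0), (4, 0, 0), (1, 4, 1), (0, 6, 0),
      (0, 0, 1), (0, 1, 5), (1, 1, 2), (0, 3, 1), (4, 0, 1), (3, 2, 0), (0, 6, 1),
      (0, 0, 2), (0, 1, 6), (1, 1, 3), (2, 1, 0), (4, 0, 2), (3, 2, 1), (2, 4, 0),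
      (0, 0, 3), (1, 0, 0), (1, 1, 4), (2, 1, 1), (1, 3, 0), (5, 0, 0), (2, 4, 1),
      (0, 0, 4), (1, 0, 1), (0, 2, 0), (2, 1, 2), (1, 3, 1), (0, 5, 0), (4, 2, 0),
      (0, 0, 5), (1, 0, 2), (0, 2, 1), (2, 1, 3), (3, 1, 0), (0, 5, 1), (4, 2, 1),
      (0, 0, 6), (1, 0, 3), (2, 0, 0), (2, 1, 4), (3, 1, 1), (2, 3, 0), (6, 0, 0),
      (0, 0, 7), (1, 0, 4), (2, 0, 1), (1, 2, 0), (3, 1, 2), (2, 3, 1), (1, 5, 0),
      (5, 2, 0), (0, 1, 0), (2, 0, 2), (1, 2, 1), (0, 4, 0), (4, 1, 0), (1, 5, 1),
      (0, 7, 0), (0, 1, 1), (2, 0, 3), (3, 0, 0), (0, 4, 1), (4, 1, 1), (3, 3, 0),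
      (7, 0, 0), (0, 1, 2), (2, 0, 4), (3, 0, 1), (2, 2, 0), (4, 1, 2), (3, 3, 1),
      (2, 5, 0), (0, 1, 3), (1, 1, 0), (3, 0, 2), (2, 2, 1), (1, 4, 0), (5, 1, 0)]"

lemma simplex_7_represents_residues:
  assumes "r \<in> {0..83::int}"
  obtains x y z where "0 \<le> x" "0 \<le> y" "0 \<le> z" "x + y + z \<le> 7"
    "(22 * x + 57 * y + 7 * z) mod 84 = r"
proof -
  \<comment> \<open>Because of the ordering, one list equality certifies all 84 classes.\<close>
  have "map (\<lambda>(x, y, z). (22 * x + 57 * y + 7 * z) mod 84) residue_witnesses = [0..83]"
    by (simp add: residue_witnesses_def upto_rec1)
  then have "r \<in> (\<lambda>(x, y, z). (22 * x + 57 * y + 7 * z) mod 84) ` set residue_witnesses"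
    using assms by (metis set_map set_upto)
  moreover have "\<forall>(x, y, z)\<in>set residue_witnesses. 0 \<le> x \<and> 0 \<le> y \<and> 0 \<le> z \<and> x + y + z \<le> 7"
    by (simp add: residue_witnesses_def)
  ultimately show ?thesis
    using that by fast
qed

text \<open>Subtracting the witness with the same residue leaves a point in the kernel of the
  form.\<close>

lemma integer_point_decomposition:
  fixes a b c :: int
  obtains x y z :: int where "0 \<le> x" "0 \<le> y" "0 \<le> z" "x + y + z \<le> 7"
    "84 dvd 22 * (a - x) + 57 * (b - y) + 7 * (c - z)"
proof -
  define r where "r = (22 * a + 57 * b + 7 * c) mod 84"
  have "r \<in> {0..83}"
    by (simp add: r_def)
  then obtain x y z where xyz: "0 \<le> x" "0 \<le> y" "0 \<le> z" "x + y + z \<le> 7"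
    and "(22 * x + 57 * y + 7 * z) mod 84 = r"
    by (rule simplex_7_represents_residues)
  then have "84 dvd (22 * a + 57 * b + 7 * c) - (22 * x + 57 * y + 7 * z)"
    by (simp only: mod_eq_dvd_iff[symmetric] r_def)
  then have "84 dvd 22 * (a - x) + 57 * (b - y) + 7 * (c - z)"
    by (simp add: algebra_simps)
  with xyz show ?thesis
    by (intro that[of x y z])
qed

theorem proposition17:
  shows "S10 + L7 = UNIV"
proof -
  have "p \<in> S10 + L7" for p :: "real ^ 3"
  proof -
    obtain x y z :: int where nonneg: "0 \<le> x" "0 \<le> y" "0 \<le> z"
      and le: "x + y + z \<le> 7"
      and dvd: "84 dvd 22 * (\<lfloor>p $ 1\<rfloor> - x) + 57 * (\<lfloor>p $ 2\<rfloor> - y) + 7 * (\<lfloor>p $ 3\<rfloor> - z)"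
      by (rule integer_point_decomposition)
    \<comment> \<open>With this lattice point, \<open>p - q\<close> is \<open>(x, y, z)\<close> plus
      the fractional parts of \<open>p\<close>.\<close>
    define q :: "real ^ 3" where
      "q = vector [of_int (\<lfloor>p $ 1\<rfloor> - x), of_int (\<lfloor>p $ 2\<rfloor> - y), of_int (\<lfloor>p $ 3\<rfloor> - z)]"
    have "q \<in> L7"
      unfolding q_def using dvd by (rule integer_point_in_L7)
    moreover have "p - q \<in> S10"
    proof -
      have "real_of_int x + real_of_int y + real_of_int z \<le> 7"
        using le by linarith
      \<comment> \<open>The closed bound 1 is enough: the coordinate sum of \<open>p - q\<close> is
        at most 7 + 3 = 10.\<close>
      moreover have "0 \<le> p $ i - of_int \<lfloor>p $ i\<rfloor>" "p $ i - of_int \<lfloor>p $ i\<rfloor> \<le> 1" for i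
        by linarith+
      note this[of 1] this[of 2] this[of 3]
      ultimately show ?thesis
        using nonneg unfolding S10_def q_def mem_Collect_eq vector_minus_component vector_3 of_int_diff
        by (smt (verit) of_int_0_le_iff)
    qed
    ultimately have "(p - q) + q \<in> S10 + L7"
      by (intro set_plus_intro)
    then show ?thesis by simp
  qed
  then show ?thesis by blast
qed

end
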